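(* Let $\mathcal{F}$ be a finite alphabet. For any $c$ (with $1\le c\le n$), and any $t_1$, $m_1$, the $c$-shingling map $\mathsf{SH}_c$ is an average-case $(t_1,t_2,m_1,m_2)$-biometric embedding of $\mathsf{Edit}_{\mathcal{F}}(n)$ into $\mathsf{SDif}(\mathcal{F}^c)$, where $t_2=(2c-1)t_1$ and $m_2=m_1-\lceil\frac nc\rceil\log_2(n-c+1)$.
   Context: $\mathsf{Edit}_{\mathcal{F}}(n)$ is the space of strings of length $n$ over $\mathcal{F}$, with distance the smallest number of character insertions and deletions transforming one string into the other. $\mathsf{SDif}(\mathcal{F}^c)$ is the set of all subsets of $\mathcal{F}^c$ with distance $|v\triangle v'|$. A $c$-shingle of $w$ is a length-$c$ consecutive substring of $w$; $\mathsf{SH}_c(w)$ is the set (ignoring order and repetition) of all $c$-shingles of $w$. Average min-entropy: $\tilde{\mathbf{H}}_\infty(A\mid B)=-\log_2\big(\mathbb{E}_{b\leftarrow B}[\max_a\Pr[A=a\mid B=b]]\big)$. A function $f:\mathcal{M}_1\to\mathcal{M}_2$ between metric spaces is an average-case $(t_1,t_2,m_1,m_2)$-biometric embedding if (i) for all $w,w'\in\mathcal{M}_1$ at distance at most $t_1$, $f(w)$ and $f(w')$ are at distance at most $t_2$; and (ii) for all random variables $W_1$ on $\mathcal{M}_1$ and $I$, $\tilde{\mathbf{H}}_\infty(W_1\mid I)\ge m_1$ implies $\tilde{\mathbf{H}}_\infty(f(W_1)\mid I)\ge m_2$. *)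

theory Defs
  imports "HOL-Probability.Probability" "HOL-Library.NList" "HOL-Library.Sublist"
begin

section \<open>The edit space\<close>

definition edit_step :: "'a set \<Rightarrow> ('a list \<times> 'a list) set" where
  "edit_step F = {(u @ v, u @ a # v) | u a v. a \<in> F} \<union> {(u @ a # v, u @ v) | u a v. a \<in> F}"

definition edit_dist :: "'a set \<Rightarrow> 'a list \<Rightarrow> 'a list \<Rightarrow> nat" where
  "edit_dist F w w' = (LEAST k. (w, w') \<in> edit_step F ^^ k)"

text \<open>Strings have length \<open>n\<close>, but the intermediate strings of an edit sequence may have any
  length. The lemma \<open>edit_reachable\<close> shows that the minimum in \<^const>\<open>edit_dist\<close> is always
  attained.\<close>

definition edit_space :: "'a set \<Rightarrow> nat \<Rightarrow> 'a list metric" where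
  "edit_space F n = metric (nlists n F, \<lambda>w w'. real (edit_dist F w w'))"

lemma edit_step_converse: "(edit_step F)\<inverse> = edit_step F"
  unfolding edit_step_def by blast

lemma edit_step_relpow_sym: "(x, y) \<in> edit_step F ^^ k \<longleftrightarrow> (y, x) \<in> edit_step F ^^ k"
proof -
  have "(y, x) \<in> edit_step F ^^ k" if "(x, y) \<in> edit_step F ^^ k" for x y
    using that
  proof (induction k arbitrary: x y)
    case (Suc k)
    then obtain z where "(x, z) \<in> edit_step F ^^ k" "(z, y) \<in> edit_step F"
      by auto
    then have "(z, x) \<in> edit_step F ^^ k" "(y, z) \<in> edit_step F"
      using Suc.IH edit_step_converse by blast+
    then show ?case
      by (rule relpow_Suc_I2[rotated])
  qed simp
  then show ?thesis by blast
qed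

lemma edit_dist_sym: "edit_dist F x y = edit_dist F y x"
  unfolding edit_dist_def by (simp add: edit_step_relpow_sym[of x y])

lemma edit_reachable_Nil: "set w \<subseteq> F \<Longrightarrow> (w, []) \<in> edit_step F ^^ length w"
proof (induction w)
  case (Cons a w)
  then have "(a # w, w) \<in> edit_step F"
    unfolding edit_step_def by (auto intro: exI[of _ "[]"])
  with Cons show ?case
    by (auto simp del: relpow.simps intro: relpow_Suc_I2)
qed simp

lemma edit_reachable:
  assumes "set x \<subseteq> F" "set y \<subseteq> F"
  shows "(x, y) \<in> edit_step F ^^ edit_dist F x y"
proof -
  have "(x, y) \<in> edit_step F ^^ (length x + length y)"
    unfolding relpow_add
    using edit_reachable_Nil[OF assms(1)] edit_reachable_Nil[OF assms(2)] edit_step_relpow_sym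
    by blast
  then show ?thesis
    unfolding edit_dist_def by (rule LeastI)
qed

lemma edit_dist_le: "(x, y) \<in> edit_step F ^^ k \<Longrightarrow> edit_dist F x y \<le> k"
  unfolding edit_dist_def by (rule Least_le)

lemma Metric_space_edit: "Metric_space (nlists n F) (\<lambda>w w'. real (edit_dist F w w'))"
proof
  fix x y assume "x \<in> nlists n F" "y \<in> nlists n F"
  then have "(x, y) \<in> edit_step F ^^ edit_dist F x y"
    by (intro edit_reachable) auto
  moreover have "edit_dist F x x = 0"
    using edit_dist_le[of x x 0 F] by simp
  ultimately show "real (edit_dist F x y) = 0 \<longleftrightarrow> x = y"
    by auto
next
  fix x y z assume "x \<in> nlists n F" "y \<in> nlists n F" "z \<in> nlists n F"
  then have "(x, z) \<in> edit_step F ^^ (edit_dist F x y + edit_dist F y z)"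
    unfolding relpow_add
    by (intro relcompI[of x y] edit_reachable) auto
  then show "real (edit_dist F x z) \<le> real (edit_dist F x y) + real (edit_dist F y z)"
    using edit_dist_le by (metis of_nat_add of_nat_le_iff)
qed (auto simp: edit_dist_sym)

lemma mspace_edit_space [simp]: "mspace (edit_space F n) = nlists n F"
  and mdist_edit_space [simp]: "mdist (edit_space F n) w w' = real (edit_dist F w w')"
  by (simp_all add: edit_space_def Metric_space.mspace_metric Metric_space.mdist_metric
      Metric_space_edit)


section \<open>The set difference space\<close>

text \<open>The universe \<open>U\<close> has to be finite for this to be a metric space.\<close>

definition sdif_space :: "'a set \<Rightarrow> 'a set metric" where
  "sdif_space U = metric (Pow U, \<lambda>v v'. real (card (sym_diff v v')))"

lemma Metric_space_sdif:
  assumes "finite U"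
  shows "Metric_space (Pow U) (\<lambda>v v'. real (card (sym_diff v v')))"
proof
  fix x y assume "x \<in> Pow U" "y \<in> Pow U"
  then have "finite x" "finite y" using assms finite_subset by auto
  then show "real (card (sym_diff x y)) = 0 \<longleftrightarrow> x = y" by auto
next
  fix x y z assume "x \<in> Pow U" "y \<in> Pow U" "z \<in> Pow U"
  then have "finite x" "finite y" "finite z" using assms finite_subset by auto
  then have "card (sym_diff x z) \<le> card (sym_diff x y \<union> sym_diff y z)"
    by (intro card_mono) auto
  also have "\<dots> \<le> card (sym_diff x y) + card (sym_diff y z)"
    by (rule card_Un_le)
  finally show "real (card (sym_diff x z)) \<le> real (card (sym_diff x y)) + real (card (sym_diff y z))"
    by linarith
qed (simp_all add: Un_commute)

lemma mspace_sdif_space [simp]: "finite U \<Longrightarrow> mspace (sdif_space U) = Pow U"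
  and mdist_sdif_space [simp]:
    "finite U \<Longrightarrow> mdist (sdif_space U) v v' = real (card (sym_diff v v'))"
  by (simp_all add: sdif_space_def Metric_space.mspace_metric Metric_space.mdist_metric
      Metric_space_sdif)


section \<open>Shingling\<close>

definition shingles :: "nat \<Rightarrow> 'a list \<Rightarrow> 'a list set" where
  "shingles c w = {v. sublist v w \<and> length v = c}"


section \<open>Average min-entropy and biometric embeddings\<close>

text \<open>This is meaningful for discrete random variables \<open>A\<close> and \<open>B\<close> on a probability space. Values
  \<open>b\<close> of probability 0 (for which \<^const>\<open>cond_prob\<close> is 0) do not contribute to the expectation over
  the distribution of \<open>B\<close>, and the supremum over \<open>a\<close> is then a maximum.\<close>

definition avg_min_entropy :: "'w measure \<Rightarrow> ('w \<Rightarrow> 'a) \<Rightarrow> ('w \<Rightarrow> 'i) \<Rightarrow> real" where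
  "avg_min_entropy \<Omega> A B =
     - log 2 (\<integral>b. (SUP a. \<P>(\<omega> in \<Omega>. A \<omega> = a \<bar> B \<omega> = b)) \<partial>distr \<Omega> (count_space UNIV) B)"

text \<open>The side information \<open>I\<close> is a discrete random variable with values in an arbitrary type.
  HOL cannot quantify over types inside a formula, so the types \<open>'w\<close> of the sample space and \<open>'i\<close>
  of the values of \<open>I\<close> are parameters; a theorem stated for type variables \<open>'w\<close> and \<open>'i\<close> covers
  all of them.\<close>

definition avg_biometric_embedding ::
  "'w itself \<Rightarrow> 'i itself \<Rightarrow> 'a metric \<Rightarrow> 'b metric \<Rightarrow> ('a \<Rightarrow> 'b) \<Rightarrow>
   real \<Rightarrow> real \<Rightarrow> real \<Rightarrow> real \<Rightarrow> bool" where
  "avg_biometric_embedding (_ :: 'w itself) (_ :: 'i itself) M1 M2 f t1 t2 m1 m2 \<longleftrightarrow>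
     f ` mspace M1 \<subseteq> mspace M2 \<and>
     (\<forall>w \<in> mspace M1. \<forall>w' \<in> mspace M1. mdist M1 w w' \<le> t1 \<longrightarrow> mdist M2 (f w) (f w') \<le> t2) \<and>
     (\<forall>(\<Omega> :: 'w measure) W (I :: 'w \<Rightarrow> 'i).
        prob_space \<Omega> \<longrightarrow>
        W \<in> measurable \<Omega> (count_space (mspace M1)) \<longrightarrow>
        I \<in> measurable \<Omega> (count_space UNIV) \<longrightarrow> countable (I ` space \<Omega>) \<longrightarrow>
        avg_min_entropy \<Omega> W I \<ge> m1 \<longrightarrow>
        avg_min_entropy \<Omega> (f \<circ> W) I \<ge> m2)"

end

theory Submission
  imports Defs
begin

text \<open>An insertion creates only shingles containing the new character (at most \<open>c\<close>) and destroys
  only shingles straddling its position (at most \<open>c - 1\<close>), so every edit operation moves the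
  shingle set by at most \<open>2 c - 1\<close>. A string of length \<open>n\<close> is recovered from its shingles at the
  positions \<open>0, c, 2 c, \<dots>\<close>, the last position being moved back to \<open>n - c\<close>. Hence at most
  \<open>(n - c + 1) ^ \<lceil>n / c\<rceil>\<close> strings share a given set of shingles, and a map whose fibres have at
  most \<open>N\<close> elements loses at most \<open>log 2 N\<close> bits of average min-entropy.\<close>

section \<open>Shingles and edit operations\<close>

text \<open>Indexing windows by their starting position makes finiteness and cardinality bounds
  immediate. The condition \<open>i + c \<le> length w\<close> avoids truncated subtraction and
  leaves no window when \<open>w\<close> is shorter than \<open>c\<close>.\<close>

lemma shingles_conv_image: "shingles c w = (\<lambda>i. take c (drop i w)) ` {i. i + c \<le> length w}"
proof (intro equalityI subsetI)
  fix v assume "v \<in> shingles c w"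
  then obtain ps ss where "w = ps @ v @ ss" "length v = c"
    by (auto simp: shingles_def sublist_def)
  then show "v \<in> (\<lambda>i. take c (drop i w)) ` {i. i + c \<le> length w}"
    by (intro image_eqI[of _ _ "length ps"]) auto
next
  fix v assume "v \<in> (\<lambda>i. take c (drop i w)) ` {i. i + c \<le> length w}"
  then obtain i where i: "v = take c (drop i w)" "i + c \<le> length w" by auto
  have "w = take i w @ v @ drop c (drop i w)"
    unfolding i(1) by (metis append_take_drop_id)
  then have "sublist v w"
    unfolding sublist_def by blast
  then show "v \<in> shingles c w"
    using i by (simp add: shingles_def)
qed

lemma finite_shingles: "finite (shingles c w)"
  unfolding shingles_conv_image
  by (rule finite_imageI) (rule finite_subset[of _ "{..length w}"], auto)

lemma card_shingles_le:
  assumes "c \<le> length w"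
  shows "card (shingles c w) \<le> length w - c + 1"
proof -
  have *: "{i. i + c \<le> length w} = {..length w - c}" using assms by auto
  show ?thesis
    unfolding shingles_conv_image *
    using card_image_le[of "{..length w - c}" "\<lambda>i. take c (drop i w)"] by simp
qed

lemma shingles_subset_nlists: "set w \<subseteq> F \<Longrightarrow> shingles c w \<subseteq> nlists c F"
  unfolding shingles_def nlists_def using set_mono_sublist by fast

text \<open>A shingle straddling the border of \<open>u\<close> and \<open>v\<close> is determined
  by the length of its part in \<open>u\<close>, so counting such shingles reduces to counting
  admissible lengths.\<close>

lemma suffix_append_prefix_eq:
  assumes "suffix xs u" "prefix ys v" "length (xs @ ys) = c"
  shows "xs @ ys = drop (length u - length xs) u @ take (c - length xs) v"
proof -
  obtain us vs where "u = us @ xs" "v = ys @ vs"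
    using assms(1,2) by (auto simp: suffix_def prefix_def)
  then show ?thesis using assms(3) by auto
qed

lemma card_shingles_insert:
  "card (shingles c (u @ a # v) - shingles c (u @ v)) \<le> c"
proof -
  let ?g = "\<lambda>k. drop (length u - k) u @ take (c - k) (a # v)"
  have "shingles c (u @ a # v) - shingles c (u @ v) \<subseteq> ?g ` {..<c}"
  proof
    fix w assume w: "w \<in> shingles c (u @ a # v) - shingles c (u @ v)"
    then have len: "length w = c" and s: "sublist w (u @ a # v)" and n: "\<not> sublist w (u @ v)"
      by (auto simp: shingles_def)
    have nu: "\<not> sublist w u" and nv: "\<not> sublist w v"
      using n by (auto simp: sublist_append)
    \<comment> \<open>A shingle inside \<open>a # v\<close> but not inside \<open>v\<close> is a
      prefix of \<open>a # v\<close>; this is the case \<open>xs = []\<close>, so length 0 is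
      counted here.\<close>
    have "\<exists>xs ys. w = xs @ ys \<and> suffix xs u \<and> prefix ys (a # v)"
      using s nu nv by (auto simp: sublist_append sublist_Cons_right intro: exI[of _ "[]"])
    then obtain xs ys where xy: "w = xs @ ys" "suffix xs u" "prefix ys (a # v)" by blast
    have "ys \<noteq> []" using xy nu by auto
    then have "length xs < c" using xy len by auto
    moreover have "w = ?g (length xs)"
      unfolding xy(1) using len xy(1) by (intro suffix_append_prefix_eq xy(2,3)) simp
    ultimately show "w \<in> ?g ` {..<c}" by blast
  qed
  then show ?thesis
    using surj_card_le[of "{..<c}"] by simp
qed

lemma card_shingles_delete:
  "card (shingles c (u @ v) - shingles c (u @ a # v)) \<le> c - 1"
proof -
  let ?g = "\<lambda>k. drop (length u - k) u @ take (c - k) v"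
  have "shingles c (u @ v) - shingles c (u @ a # v) \<subseteq> ?g ` {1..<c}"
  proof
    fix w assume w: "w \<in> shingles c (u @ v) - shingles c (u @ a # v)"
    then have len: "length w = c" and s: "sublist w (u @ v)" and n: "\<not> sublist w (u @ a # v)"
      by (auto simp: shingles_def)
    have nu: "\<not> sublist w u" and nv: "\<not> sublist w v"
      using n by (auto simp: sublist_append sublist_Cons_right)
    obtain xs ys where xy: "w = xs @ ys" "suffix xs u" "prefix ys v"
      using s nu nv by (auto simp: sublist_append)
    \<comment> \<open>Shingles inside \<open>u\<close> or inside \<open>v\<close> survive, so a lost
      one has characters on both sides: length 0 drops out and \<open>c - 1\<close> lengths
      remain.\<close>
    have "ys \<noteq> []" "xs \<noteq> []" using xy nu nv by auto
    then have "length xs \<in> {1..<c}" using xy len by (cases xs) auto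
    moreover have "w = ?g (length xs)"
      unfolding xy(1) using len xy(1) by (intro suffix_append_prefix_eq xy(2,3)) simp
    ultimately show "w \<in> ?g ` {1..<c}" by blast
  qed
  then show ?thesis
    using surj_card_le[of "{1..<c}"] by simp
qed

lemma card_sym_diff_shingles_step:
  assumes "(x, y) \<in> edit_step F"
  shows "card (sym_diff (shingles c x) (shingles c y)) \<le> c + (c - 1)"
proof -
  have *: "card (sym_diff (shingles c (u @ v)) (shingles c (u @ a # v))) \<le> c + (c - 1)" for u a v
    using card_Un_le[of "shingles c (u @ v) - shingles c (u @ a # v)"
        "shingles c (u @ a # v) - shingles c (u @ v)"]
      card_shingles_insert[of c u a v] card_shingles_delete[of c u v a] by linarith
  show ?thesis
    using assms * by (auto simp: edit_step_def Un_commute)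
qed

text \<open>Triangle inequality along the edit sequence. The intermediate strings may have any
  length, and the one-step bound covers them all.\<close>

lemma card_sym_diff_shingles_relpow:
  assumes "(x, y) \<in> edit_step F ^^ k"
  shows "card (sym_diff (shingles c x) (shingles c y)) \<le> (c + (c - 1)) * k"
  using assms
proof (induction k arbitrary: y)
  case (Suc k)
  then obtain z where z: "(x, z) \<in> edit_step F ^^ k" "(z, y) \<in> edit_step F" by auto
  have "card (sym_diff (shingles c x) (shingles c y))
      \<le> card (sym_diff (shingles c x) (shingles c z) \<union> sym_diff (shingles c z) (shingles c y))"
    by (intro card_mono) (auto simp: finite_shingles)
  also have "\<dots> \<le> card (sym_diff (shingles c x) (shingles c z))
      + card (sym_diff (shingles c z) (shingles c y))"
    by (rule card_Un_le)
  also have "\<dots> \<le> (c + (c - 1)) * k + (c + (c - 1))"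
    by (intro add_mono Suc.IH z(1) card_sym_diff_shingles_step[OF z(2)])
  finally show ?case by simp
qed simp

section \<open>Strings with a given set of shingles\<close>

text \<open>The cap at \<open>n - c\<close> keeps the last window inside the string; it overlaps its
  predecessor when \<open>c\<close> does not divide \<open>n\<close>.\<close>

definition cover_pos :: "nat \<Rightarrow> nat \<Rightarrow> nat \<Rightarrow> nat" where
  "cover_pos c n j = min (j * c) (n - c)"

lemma cover_pos_bounds:
  assumes "1 \<le> c" "c \<le> n" "p < n"
  shows "cover_pos c n (p div c) \<le> p" "p < cover_pos c n (p div c) + c"
proof -
  have "p div c * c \<le> p" by simp
  then show "cover_pos c n (p div c) \<le> p"
    unfolding cover_pos_def by (rule min.coboundedI1)
  have "p mod c < c" using assms(1) by simp
  then have "p < p div c * c + c"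
    using div_mult_mod_eq[of p c] by linarith
  \<comment> \<open>A capped window ends exactly at \<open>n\<close>, which exceeds
    \<open>p\<close>.\<close>
  then show "p < cover_pos c n (p div c) + c"
    using assms by (auto simp: cover_pos_def min_def)
qed

lemma card_same_shingles_le:
  assumes "finite F" "1 \<le> c" "c \<le> n"
  shows "card {w \<in> nlists n F. shingles c w = v} \<le> (n - c + 1) ^ nat \<lceil>real n / real c\<rceil>"
proof (cases "{w \<in> nlists n F. shingles c w = v} = {}")
  case False
  let ?S = "{w \<in> nlists n F. shingles c w = v}"
  define K where "K = nat \<lceil>real n / real c\<rceil>"
  \<comment> \<open>The set \<open>v\<close> forgets where its shingles occur; \<open>g w\<close>
    restores this by listing the covering windows in order.\<close>
  define g :: "'a list \<Rightarrow> 'a list list"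
    where "g w = map (\<lambda>j. take c (drop (cover_pos c n j) w)) [0..<K]" for w
  \<comment> \<open>\<open>v\<close> is arbitrary; a member of its fibre shows that it is finite and
    has at most \<open>n - c + 1\<close> elements.\<close>
  obtain w0 where w0: "w0 \<in> nlists n F" "shingles c w0 = v" using False by auto
  have finv: "finite v" using w0 finite_shingles by blast
  have cardv: "card v \<le> n - c + 1"
    using w0 card_shingles_le[of c w0] assms by auto
  have "inj_on g ?S"
  proof (rule inj_onI)
    fix x y assume x: "x \<in> ?S" and y: "y \<in> ?S" and eq: "g x = g y"
    have lx: "length x = n" and ly: "length y = n" using x y by auto
    show "x = y"
    proof (rule nth_equalityI)
      show "length x = length y" using lx ly by simp
      fix p assume "p < length x"
      then have p: "p < n" using lx by simp
      let ?q = "cover_pos c n (p div c)"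
      note b = cover_pos_bounds[OF assms(2,3) p]
      \<comment> \<open>The window covering position \<open>p\<close> has index below
        \<open>K\<close>, so \<open>g\<close> records it, and the character is read off at offset
        \<open>p - ?q\<close>.\<close>
      have "real (p div c) \<le> real p / real c" by (rule of_nat_div_le_of_nat)
      also have "\<dots> < real n / real c" using p assms by (simp add: divide_strict_right_mono)
      also have "\<dots> \<le> real K" unfolding K_def by (rule real_nat_ceiling_ge)
      finally have "p div c < K" by simp
      then have "take c (drop ?q x) = take c (drop ?q y)"
        using arg_cong[OF eq, of "\<lambda>l. l ! (p div c)"] by (simp add: g_def)
      then have "take c (drop ?q x) ! (p - ?q) = take c (drop ?q y) ! (p - ?q)" by simp
      then show "x ! p = y ! p"
        using b p lx ly by simp
    qed
  qed
  moreover have "g ` ?S \<subseteq> {xs. set xs \<subseteq> v \<and> length xs = K}"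
  proof -
    have "take c (drop (cover_pos c n j) w) \<in> v" if "w \<in> ?S" for w j
    proof -
      have "cover_pos c n j + c \<le> length w"
        using that assms by (auto simp: cover_pos_def)
      then show ?thesis
        using that by (auto simp: shingles_conv_image)
    qed
    then show ?thesis unfolding g_def by auto
  qed
  ultimately have "card ?S \<le> card {xs. set xs \<subseteq> v \<and> length xs = K}"
    by (intro card_inj_on_le) (auto intro: finite_lists_length_eq finv)
  also have "\<dots> = card v ^ K" by (rule card_lists_length_eq[OF finv])
  also have "\<dots> \<le> (n - c + 1) ^ K" by (rule power_mono[OF cardv]) simp
  finally show ?thesis unfolding K_def .
next
  case True
  show ?thesis unfolding True by simp
qed

section \<open>Average min-entropy under maps with small fibres\<close>

context prob_space
begin

text \<open>Arbitrary \<open>P\<close> and \<open>Q\<close> are allowed: if \<open>Q\<close> is not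
  an event, its measure and hence the quotient default to 0.\<close>

lemma cond_prob_le_1: "cond_prob M P Q \<le> 1"
proof (cases "{x \<in> space M. Q x} \<in> events")
  case True
  then have "prob {x \<in> space M. P x \<and> Q x} \<le> prob {x \<in> space M. Q x}"
    by (intro finite_measure_mono) auto
  then show ?thesis
    unfolding cond_prob_def by (simp add: divide_le_eq_1 zero_less_measure_iff)
next
  case False
  then show ?thesis by (simp add: cond_prob_def measure_notin_sets)
qed

lemma bdd_above_cond_prob: "bdd_above (range (\<lambda>a. cond_prob M (\<lambda>x. A x = a) Q))"
  by (rule bdd_aboveI[of _ 1]) (auto intro: cond_prob_le_1)

lemma SUP_cond_prob_bounds:
  "0 \<le> (SUP a. cond_prob M (\<lambda>x. A x = a) Q)" "(SUP a. cond_prob M (\<lambda>x. A x = a) Q) \<le> 1"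
proof -
  have "0 \<le> cond_prob M (\<lambda>x. A x = undefined) Q"
    by (simp add: cond_prob_def)
  also have "\<dots> \<le> (SUP a. cond_prob M (\<lambda>x. A x = a) Q)"
    by (rule cSUP_upper[OF UNIV_I bdd_above_cond_prob])
  finally show "0 \<le> (SUP a. cond_prob M (\<lambda>x. A x = a) Q)" .
  show "(SUP a. cond_prob M (\<lambda>x. A x = a) Q) \<le> 1"
    by (rule cSUP_least) (auto intro: cond_prob_le_1)
qed

text \<open>The integrand takes values in [0, 1], and every function on
  \<open>count_space UNIV\<close> is measurable.\<close>

lemma integrable_SUP_cond_prob:
  assumes "I \<in> measurable M (count_space UNIV)"
  shows "integrable (distr M (count_space UNIV) I) (\<lambda>b. SUP a. cond_prob M (\<lambda>x. A x = a) (\<lambda>x. I x = b))"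
proof -
  interpret D: prob_space "distr M (count_space UNIV) I"
    by (rule prob_space_distr[OF assms])
  show ?thesis
    by (rule D.integrable_const_bound[where B = 1])
      (auto simp: SUP_cond_prob_bounds)
qed

lemma cond_prob_finite_sum:
  assumes "finite S" "W \<in> measurable M (count_space S)" "T \<subseteq> S"
    and Q: "{x \<in> space M. Q x} \<in> events"
  shows "cond_prob M (\<lambda>x. W x \<in> T) Q = (\<Sum>w\<in>T. cond_prob M (\<lambda>x. W x = w) Q)"
proof -
  have fin: "finite T" using assms finite_subset by blast
  have ev: "{x \<in> space M. W x = w \<and> Q x} \<in> events" if "w \<in> T" for w
  proof -
    have "W -` {w} \<inter> space M \<in> events"
      using that assms by (intro measurable_sets[OF assms(2)]) auto
    then have "(W -` {w} \<inter> space M) \<inter> {x \<in> space M. Q x} \<in> events" using Q by (rule sets.Int)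
    moreover have "(W -` {w} \<inter> space M) \<inter> {x \<in> space M. Q x} = {x \<in> space M. W x = w \<and> Q x}"
      by auto
    ultimately show ?thesis by simp
  qed
  have "{x \<in> space M. W x \<in> T \<and> Q x} = (\<Union>w\<in>T. {x \<in> space M. W x = w \<and> Q x})" by auto
  then have "prob {x \<in> space M. W x \<in> T \<and> Q x} = (\<Sum>w\<in>T. prob {x \<in> space M. W x = w \<and> Q x})"
    using fin ev by (simp, intro finite_measure_finite_Union) (auto simp: disjoint_family_on_def)
  then show ?thesis
    by (simp add: cond_prob_def sum_divide_distrib)
qed

text \<open>By countability of the range, the values of probability 0 that \<open>I\<close> attains
  have a null preimage, being a countable union of null events.\<close>

lemma AE_distr_pos_prob:
  assumes I: "I \<in> measurable M (count_space UNIV)" and "countable (I ` space M)"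
  shows "AE b in distr M (count_space UNIV) I. 0 < prob {x \<in> space M. I x = b}"
proof -
  let ?ev = "\<lambda>b. {x \<in> space M. I x = b}"
  define Z where "Z = {b \<in> I ` space M. prob (?ev b) = 0}"
  have ev: "?ev b \<in> events" for b
    using measurable_sets[OF I, of "{b}"] by (simp add: vimage_def Int_def conj_commute)
  have Z: "countable Z" unfolding Z_def using assms(2) by (rule countable_subset[rotated]) auto
  have "(\<Union>b\<in>Z. ?ev b) \<in> null_sets M"
    by (rule null_sets_UN'[OF Z]) (use ev in \<open>auto simp: Z_def emeasure_eq_measure null_sets_def\<close>)
  then have "AE x in M. 0 < prob (?ev (I x))"
    by (rule AE_I') (auto simp: Z_def zero_less_measure_iff)
  then show ?thesis
    by (simp add: AE_distr_iff[OF I])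
qed

text \<open>For each \<open>b\<close>, a fibre of \<open>f\<close> carries at most \<open>N\<close>
  times the largest conditional probability of a single value. Integrating over \<open>b\<close> and
  taking logarithms gives the bound.\<close>

lemma avg_min_entropy_image_ge:
  assumes fin: "finite S" and W: "W \<in> measurable M (count_space S)"
    and I: "I \<in> measurable M (count_space UNIV)" and cI: "countable (I ` space M)"
    and N: "\<And>v. card {w \<in> S. f w = v} \<le> N"
  shows "avg_min_entropy M W I - log 2 (real N) \<le> avg_min_entropy M (f \<circ> W) I"
proof -
  let ?D = "distr M (count_space UNIV) I"
  let ?p = "\<lambda>w b. cond_prob M (\<lambda>x. W x = w) (\<lambda>x. I x = b)"
  let ?q = "\<lambda>v b. cond_prob M (\<lambda>x. (f \<circ> W) x = v) (\<lambda>x. I x = b)"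
  define E where "E = (\<integral>b. (SUP w. ?p w b) \<partial>?D)"
  define E' where "E' = (\<integral>b. (SUP v. ?q v b) \<partial>?D)"
  interpret D: prob_space ?D by (rule prob_space_distr[OF I])
  have ev: "{x \<in> space M. I x = b} \<in> events" for b
    using measurable_sets[OF I, of "{b}"] by (simp add: vimage_def Int_def conj_commute)
  have WS: "W x \<in> S" if "x \<in> space M" for x
    using measurable_space[OF W that] by simp
  have p_le: "?p w b \<le> (SUP w. ?p w b)" for w b
    by (rule cSUP_upper[OF UNIV_I bdd_above_cond_prob])
  have sum_le: "cond_prob M (\<lambda>x. W x \<in> T) (\<lambda>x. I x = b) \<le> card T * (SUP w. ?p w b)"
    if "T \<subseteq> S" for T b
    unfolding cond_prob_finite_sum[OF fin W that ev] by (rule sum_bounded_above[OF p_le])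
  have q_le: "(SUP v. ?q v b) \<le> N * (SUP w. ?p w b)" for b
  proof (rule cSUP_least)
    fix v
    have "{x \<in> space M. (f \<circ> W) x = v \<and> I x = b} =
        {x \<in> space M. W x \<in> {w \<in> S. f w = v} \<and> I x = b}"
      using WS by auto
    then have "?q v b = cond_prob M (\<lambda>x. W x \<in> {w \<in> S. f w = v}) (\<lambda>x. I x = b)"
      unfolding cond_prob_def by simp
    also have "\<dots> \<le> card {w \<in> S. f w = v} * (SUP w. ?p w b)"
      by (rule sum_le) auto
    also have "\<dots> \<le> N * (SUP w. ?p w b)"
      by (intro mult_right_mono SUP_cond_prob_bounds) (simp add: N)
    finally show "?q v b \<le> N * (SUP w. ?p w b)" .
  qed simp
  \<comment> \<open>The reverse comparison, from the event \<open>W x = w\<close> implying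
    \<open>f (W x) = f w\<close>. It makes \<open>E'\<close> positive once \<open>E\<close> is, as
    monotonicity of the logarithm requires.\<close>
  have p_le_q: "(SUP w. ?p w b) \<le> (SUP v. ?q v b)" for b
  proof (rule cSUP_least)
    fix w
    have "f \<circ> W \<in> measurable M (count_space UNIV)"
      using measurable_comp[OF W, of f "count_space UNIV"] by simp
    from measurable_sets[OF this, of "{f w}"]
    have "{x \<in> space M. (f \<circ> W) x = f w} \<in> events"
      by (simp add: vimage_def Int_def conj_commute)
    then have "{x \<in> space M. (f \<circ> W) x = f w} \<inter> {x \<in> space M. I x = b} \<in> events"
      using ev by (rule sets.Int)
    moreover have "{x \<in> space M. (f \<circ> W) x = f w} \<inter> {x \<in> space M. I x = b} =
        {x \<in> space M. (f \<circ> W) x = f w \<and> I x = b}" by auto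
    ultimately have "{x \<in> space M. (f \<circ> W) x = f w \<and> I x = b} \<in> events" by simp
    then have "?p w b \<le> ?q (f w) b"
      unfolding cond_prob_def by (intro divide_right_mono finite_measure_mono) auto
    also have "\<dots> \<le> (SUP v. ?q v b)"
      by (rule cSUP_upper[OF UNIV_I bdd_above_cond_prob])
    finally show "?p w b \<le> (SUP v. ?q v b)" .
  qed simp
  have "E' \<le> (\<integral>b. N * (SUP w. ?p w b) \<partial>?D)"
    unfolding E'_def
    by (intro integral_mono integrable_mult_right integrable_SUP_cond_prob I q_le)
  then have E'_le: "E' \<le> N * E" by (simp add: E_def)
  have E_le: "E \<le> E'"
    unfolding E_def E'_def by (intro integral_mono integrable_SUP_cond_prob I p_le_q)
  \<comment> \<open>Where \<open>b\<close> has positive probability, the conditional probabilities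
    over the finite set \<open>S\<close> sum to 1, so the largest is at least
    \<open>1 / card S\<close>. This keeps \<open>E\<close> away from 0.\<close>
  have "AE b in ?D. 1 \<le> card S * (SUP w. ?p w b)"
    using AE_distr_pos_prob[OF I cI]
  proof eventually_elim
    case (elim b)
    have "{x \<in> space M. W x \<in> S \<and> I x = b} = {x \<in> space M. I x = b}" using WS by auto
    then have "cond_prob M (\<lambda>x. W x \<in> S) (\<lambda>x. I x = b) = 1"
      using elim by (simp add: cond_prob_def)
    then show ?case using sum_le[of S b] by simp
  qed
  then have "(\<integral>b. 1 \<partial>?D) \<le> (\<integral>b. card S * (SUP w. ?p w b) \<partial>?D)"
    by (intro integral_mono_AE integrable_mult_right integrable_SUP_cond_prob I) auto
  then have "1 \<le> card S * E"
    using D.prob_space by (simp add: E_def)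
  then have "0 < card S * E" by linarith
  then have E_pos: "0 < E" by (simp add: zero_less_mult_iff)
  then have "0 < N * E" using E_le E'_le by linarith
  then have N_pos: "0 < real N" by (simp add: zero_less_mult_iff)
  have "log 2 E' \<le> log 2 (N * E)"
    using E_pos E_le E'_le by (intro log_mono) auto
  also have "\<dots> = log 2 N + log 2 E"
    using E_pos N_pos by (simp add: log_mult)
  finally show ?thesis
    unfolding avg_min_entropy_def E_def[symmetric] E'_def[symmetric] by simp
qed

end

section \<open>Combining the distance and entropy bounds\<close>

theorem lemma7p3:
  fixes F :: "'a set" and c n :: nat and t1 m1 :: real
  assumes "finite F" and "1 \<le> c" and "c \<le> n"
  shows "avg_biometric_embedding TYPE('w) TYPE('i)
           (edit_space F n) (sdif_space (nlists c F)) (shingles c)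
           t1 ((2 * real c - 1) * t1)
           m1 (m1 - of_int \<lceil>real n / real c\<rceil> * log 2 (real n - real c + 1))"
proof -
  \<comment> \<open>Used with \<open>k = c\<close> for the universe of the set difference space and
    with \<open>k = n\<close> for the range of \<open>W\<close>.\<close>
  have fin: "finite (nlists k F)" for k
    unfolding nlists_def
    by (rule finite_subset[OF _ finite_lists_length_eq[OF assms(1), of k]]) blast
  show ?thesis
    unfolding avg_biometric_embedding_def mspace_edit_space mspace_sdif_space[OF fin]
      mdist_edit_space mdist_sdif_space[OF fin]
  proof (intro conjI ballI allI impI)
    show "shingles c ` nlists n F \<subseteq> Pow (nlists c F)"
    proof (rule image_subsetI)
      fix w assume "w \<in> nlists n F"
      then have "set w \<subseteq> F" by (rule nlistsE_set)
      then show "shingles c w \<in> Pow (nlists c F)"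
        by (intro PowI shingles_subset_nlists)
    qed
  next
    fix w w' assume w: "w \<in> nlists n F" "w' \<in> nlists n F" and d: "real (edit_dist F w w') \<le> t1"
    have "(w, w') \<in> edit_step F ^^ edit_dist F w w'"
      using w by (intro edit_reachable nlistsE_set)
    then have "card (sym_diff (shingles c w) (shingles c w')) \<le> (c + (c - 1)) * edit_dist F w w'"
      by (rule card_sym_diff_shingles_relpow)
    then have "real (card (sym_diff (shingles c w) (shingles c w')))
        \<le> real ((c + (c - 1)) * edit_dist F w w')"
      by (rule of_nat_mono)
    also have "\<dots> = (2 * real c - 1) * real (edit_dist F w w')"
      using assms(2) by (simp add: of_nat_diff)
    \<comment> \<open>The factor is nonnegative because \<open>1 \<le> c\<close>.\<close>
    also have "\<dots> \<le> (2 * real c - 1) * t1"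
      using assms(2) d by (intro mult_left_mono) auto
    finally show "real (card (sym_diff (shingles c w) (shingles c w'))) \<le> (2 * real c - 1) * t1" .
  next
    fix \<Omega> :: "'w measure" and W and I :: "'w \<Rightarrow> 'i"
    assume "prob_space \<Omega>" and W: "W \<in> measurable \<Omega> (count_space (nlists n F))"
      and I: "I \<in> measurable \<Omega> (count_space UNIV)" "countable (I ` space \<Omega>)"
      and m: "m1 \<le> avg_min_entropy \<Omega> W I"
    interpret prob_space \<Omega> by fact
    let ?K = "nat \<lceil>real n / real c\<rceil>"
    have "log 2 (real ((n - c + 1) ^ ?K)) = real ?K * log 2 (real (n - c + 1))"
      unfolding of_nat_power by (rule log_nat_power) simp
    \<comment> \<open>The ceiling is nonnegative, so \<open>nat\<close> preserves it;
      \<open>c \<le> n\<close> makes the natural subtraction exact.\<close>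
    also have "\<dots> = of_int \<lceil>real n / real c\<rceil> * log 2 (real n - real c + 1)"
      using assms(3) by (simp add: of_nat_diff add.commute)
    finally have "log 2 (real ((n - c + 1) ^ ?K))
        = of_int \<lceil>real n / real c\<rceil> * log 2 (real n - real c + 1)" .
    moreover have "avg_min_entropy \<Omega> W I - log 2 (real ((n - c + 1) ^ ?K))
        \<le> avg_min_entropy \<Omega> (shingles c \<circ> W) I"
      by (rule avg_min_entropy_image_ge[OF fin W I]) (rule card_same_shingles_le[OF assms])
    ultimately show "m1 - of_int \<lceil>real n / real c\<rceil> * log 2 (real n - real c + 1)
        \<le> avg_min_entropy \<Omega> (shingles c \<circ> W) I"
      using m by linarith
  qed
qed

end
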